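(* The system $$x_{k+1}=\Big(A+\sum_{i=1}^M\sigma_k(i)A_i\Big)x_k+Bu_k+w_k,\qquad x_0=0,$$ is stabilizable in the mean square sense if and only if there exists a matrix $V\succeq0$ (real symmetric, of size $(n+m)\times(n+m)$) such that $$FVF^T=\begin{bmatrix}A&B\end{bmatrix}V\begin{bmatrix}A&B\end{bmatrix}^T+\sum_{i=1}^MA_iFVF^TA_i^T+I,$$ where $F=\begin{bmatrix}I_n&0\end{bmatrix}\in\mathbb{R}^{n\times(n+m)}$.
   Context: Here $x_k\in\mathbb{R}^n$, $u_k\in\mathbb{R}^m$, and $A,A_1,\dots,A_M\in\mathbb{R}^{n\times n}$, $B\in\mathbb{R}^{n\times m}$ are given real matrices. The noises $w_k\in\mathbb{R}^n$ and $\sigma_k(i)\in\mathbb{R}$ ($k\ge0$, $1\le i\le M$) are zero-mean, square-integrable, mutually independent (over all $k$ and $i$), with arbitrary probability distributions, $\mathbf{E}\{w_kw_k^T\}=I$ and $\mathbf{E}\{\sigma_k(i)^2\}=1$. The system is stabilizable in the mean square sense if there is a causal state-feedback controller $u_k=\mu_k(x_0,\dots,x_k)$ (measurable $\mu_k$, possibly nonlinear, with $u_k$ having finite second moments) such that $\sup_{k\ge0}\mathbf{E}\{x_k^Tx_k\}<\infty$. $V\succeq0$ means symmetric positive semidefinite. *)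

theory Defs
  imports "HOL-Probability.Probability"
begin

definition psd :: "real^'n^'n \<Rightarrow> bool" where
  "psd V \<longleftrightarrow> transpose V = V \<and> (\<forall>z. 0 \<le> z \<bullet> (V *v z))"

definition hcat :: "real^'n^'r \<Rightarrow> real^'m^'r \<Rightarrow> real^('n::finite + 'm::finite)^'r" where
  "hcat A B = (\<chi> i j. case j of Inl a \<Rightarrow> A $ i $ a | Inr b \<Rightarrow> B $ i $ b)"

definition Fmat :: "real^('n::finite + 'm::finite)^'n" where
  "Fmat = hcat (mat 1) 0"

definition square_integrable :: "'a measure \<Rightarrow> ('a \<Rightarrow> 'b::euclidean_space) \<Rightarrow> bool" where
  "square_integrable P f \<longleftrightarrow> f \<in> borel_measurable P \<and> integrable P (\<lambda>\<omega>. (norm (f \<omega>))\<^sup>2)"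

text \<open>
  The random vectors \<open>w k\<close> and the random scalars \<open>\<sigma> k i\<close> have different types, so
  \<open>indep_vars\<close> cannot express that they are all mutually independent; \<open>mutually_independent\<close>
  says that the sigma-algebras they generate are independent, as in \<open>indep_vars_def2\<close>.
\<close>

fun noise_events ::
  "'a measure \<Rightarrow> (nat \<Rightarrow> 'a \<Rightarrow> real^'n) \<Rightarrow> (nat \<Rightarrow> nat \<Rightarrow> 'a \<Rightarrow> real) \<Rightarrow> nat + nat \<times> nat \<Rightarrow> 'a set set"
where
  "noise_events P w \<sigma> (Inl k) = {w k -` S \<inter> space P | S. S \<in> sets borel}"
| "noise_events P w \<sigma> (Inr (k, i)) = {\<sigma> k i -` S \<inter> space P | S. S \<in> sets borel}"

definition mutually_independent ::
  "'a measure \<Rightarrow> nat \<Rightarrow> (nat \<Rightarrow> 'a \<Rightarrow> real^'n) \<Rightarrow> (nat \<Rightarrow> nat \<Rightarrow> 'a \<Rightarrow> real) \<Rightarrow> bool"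
where
  "mutually_independent P M w \<sigma> \<longleftrightarrow>
    prob_space.indep_sets P (noise_events P w \<sigma>) (UNIV <+> (UNIV \<times> {1..M}))"

text \<open>
  A controller \<open>\<mu>\<close> at time \<open>k\<close> is applied to the history \<open>(x\<^sub>0, \<dots>, x\<^sub>k)\<close>, which is an
  element of the product space indexed by \<open>{..k}\<close>.
\<close>

definition causal_controller :: "(nat \<Rightarrow> (nat \<Rightarrow> real^'n) \<Rightarrow> real^'m) \<Rightarrow> bool" where
  "causal_controller \<mu> \<longleftrightarrow> (\<forall>k. \<mu> k \<in> borel_measurable (\<Pi>\<^sub>M j\<in>{..k}. borel))"

definition feedback ::
  "(nat \<Rightarrow> (nat \<Rightarrow> real^'n) \<Rightarrow> real^'m) \<Rightarrow> (nat \<Rightarrow> 'a \<Rightarrow> real^'n) \<Rightarrow> nat \<Rightarrow> 'a \<Rightarrow> real^'m"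
where
  "feedback \<mu> x k \<omega> = \<mu> k (\<lambda>j\<in>{..k}. x j \<omega>)"

definition system_trajectory ::
  "'a measure \<Rightarrow> nat \<Rightarrow> real^'n^'n \<Rightarrow> (nat \<Rightarrow> real^'n^'n) \<Rightarrow> real^'m^'n \<Rightarrow>
   (nat \<Rightarrow> 'a \<Rightarrow> real^'n) \<Rightarrow> (nat \<Rightarrow> nat \<Rightarrow> 'a \<Rightarrow> real) \<Rightarrow>
   (nat \<Rightarrow> 'a \<Rightarrow> real^'n) \<Rightarrow> (nat \<Rightarrow> 'a \<Rightarrow> real^'m) \<Rightarrow> bool"
where
  "system_trajectory P M A As B w \<sigma> x u \<longleftrightarrow>
    (\<forall>\<omega>\<in>space P. x 0 \<omega> = 0 \<and>
      (\<forall>k. x (Suc k) \<omega> =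
        (A + (\<Sum>i=1..M. \<sigma> k i \<omega> *\<^sub>R As i)) *v x k \<omega> + B *v u k \<omega> + w k \<omega>))"

text \<open>
  The second moments of the state are taken in \<open>ennreal\<close>, so that a state without a finite
  second moment counts as unbounded (the Bochner integral would be \<open>0\<close>).
\<close>

definition mean_square_stabilizable ::
  "'a measure \<Rightarrow> nat \<Rightarrow> real^'n^'n \<Rightarrow> (nat \<Rightarrow> real^'n^'n) \<Rightarrow> real^'m^'n \<Rightarrow>
   (nat \<Rightarrow> 'a \<Rightarrow> real^'n) \<Rightarrow> (nat \<Rightarrow> nat \<Rightarrow> 'a \<Rightarrow> real) \<Rightarrow> bool"
where
  "mean_square_stabilizable P M A As B w \<sigma> \<longleftrightarrow>
    (\<exists>\<mu> x. causal_controller \<mu> \<and>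
      system_trajectory P M A As B w \<sigma> x (feedback \<mu> x) \<and>
      (\<forall>k. square_integrable P (feedback \<mu> x k)) \<and>
      (SUP k. \<integral>\<^sup>+ \<omega>. ennreal (x k \<omega> \<bullet> x k \<omega>) \<partial>P) < \<infinity>)"

end

theory Submission
  imports Defs
begin

text \<open>
  Testing with vectors \<open>p\<close> turns matrices into quadratic forms: the independence of the noises gives
  \<open>E (p \<bullet> x\<^sub>k\<^sub>+\<^sub>1)\<^sup>2 = E (p \<bullet> (A x\<^sub>k + B u\<^sub>k))\<^sup>2 + (\<Sum>i. E (p \<bullet> A\<^sub>i x\<^sub>k)\<^sup>2) + p \<bullet> p\<close>, which is the matrix equation
  for the second moment \<open>V\<^sub>k\<close> of \<open>(x\<^sub>k, u\<^sub>k)\<close> except that the left-hand side belongs to \<open>V\<^sub>k\<^sub>+\<^sub>1\<close>. For a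
  stabilizing controller the Cesaro means of the \<open>V\<^sub>k\<close> therefore satisfy the equation up to a
  telescoping error \<open>O(1/N)\<close>, and a limit point solves it. Conversely, for a solution \<open>V\<close> with blocks
  \<open>X\<close>, \<open>Y\<close>, \<open>Z\<close> the linear feedback \<open>u = Y\<^sup>T X\<^sup>-\<^sup>1 x\<close> keeps \<open>E (p \<bullet> x\<^sub>k)\<^sup>2 \<le> p \<bullet> X p\<close>, by induction on \<open>k\<close>.
\<close>

subsection \<open>Quadratic forms and block vectors\<close>

lemma inner_transpose:
  fixes A :: "real^'n^'m"
  shows "(transpose A *v p) \<bullet> q = p \<bullet> (A *v q)"
  by (simp add: transpose_matrix_vector dot_lmul_matrix)

definition qform :: "real^'n^'n \<Rightarrow> real^'n \<Rightarrow> real" where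
  "qform V y = y \<bullet> (V *v y)"

lemma qform_congruence:
  fixes C :: "real^'n^'m"
  shows "qform (C ** V ** transpose C) p = qform V (transpose C *v p)"
proof -
  have "qform (C ** V ** transpose C) p = p \<bullet> (C *v (V *v (transpose C *v p)))"
    by (simp only: qform_def matrix_vector_mul_assoc matrix_mul_assoc)
  then show ?thesis
    by (simp only: qform_def inner_transpose)
qed

lemma qform_mat_1: "qform (mat 1) p = p \<bullet> p"
  by (simp add: qform_def)

lemma qform_add: "qform (V + W) p = qform V p + qform W p"
  by (simp add: qform_def matrix_vector_mult_add_rdistrib inner_add_right)

lemma qform_diff: "qform (V - W) p = qform V p - qform W p"
  by (simp add: qform_def matrix_vector_mult_diff_rdistrib inner_diff_right)

lemma qform_scaleR: "qform (c *\<^sub>R V) p = c * qform V p"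
  by (simp add: qform_def scaleR_matrix_vector_assoc [symmetric])

lemma qform_sum: "qform (\<Sum>i\<in>I. V i) p = (\<Sum>i\<in>I. qform (V i) p)"
  by (induction I rule: infinite_finite_induct) (auto simp: qform_add, auto simp: qform_def)

lemma bounded_linear_qform: "bounded_linear (\<lambda>V. qform V p)"
  unfolding linear_conv_bounded_linear [symmetric]
  by (rule linearI) (simp_all add: qform_add qform_scaleR)

lemma bounded_linear_transpose: "bounded_linear (transpose :: real^'n^'m \<Rightarrow> _)"
  unfolding linear_conv_bounded_linear [symmetric]
  by (rule linearI) (simp_all add: transpose_def vec_eq_iff)

lemma transpose_sum:
  fixes G :: "'i \<Rightarrow> real^'n^'m"
  shows "transpose (\<Sum>i\<in>I. G i) = (\<Sum>i\<in>I. transpose (G i))"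
  by (rule linear_sum [OF bounded_linear.linear [OF bounded_linear_transpose]])

text \<open>Polarization: if the form of the symmetric difference \<open>S\<close> vanishes at p, q
  and p + q, then the bilinear term p \<bullet> S q vanishes as well, so \<open>S\<close> maps every
  q to 0.\<close>

lemma symmetric_eq_iff_qform:
  fixes V W :: "real^'n^'n"
  assumes "transpose V = V" "transpose W = W"
  shows "V = W \<longleftrightarrow> (\<forall>p. qform V p = qform W p)"
proof
  assume eq: "\<forall>p. qform V p = qform W p"
  define S where "S = V - W"
  have sym: "transpose S = S"
    using assms by (simp add: S_def vec_eq_iff transpose_def)
  have zero: "p \<bullet> (S *v p) = 0" for p
    using eq qform_diff [of V W p] by (simp add: qform_def S_def)
  have "S *v q = 0" for q
  proof -
    have "p \<bullet> (S *v q) = 0" for p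
    proof -
      have "q \<bullet> (S *v p) = p \<bullet> (S *v q)"
        using inner_transpose [of S q p] sym by (simp add: inner_commute)
      then show ?thesis
        using zero [of "p + q"] zero [of p] zero [of q]
        by (simp add: matrix_vector_right_distrib inner_add_left inner_add_right)
    qed
    then show ?thesis
      using inner_eq_zero_iff by blast
  qed
  then show "V = W"
    by (simp add: matrix_eq S_def matrix_vector_mult_diff_rdistrib)
qed simp

lemma sum_scaleR_matrix_vector_mult:
  fixes C :: "'i \<Rightarrow> real^'n^'m"
  shows "(\<Sum>i\<in>I. c i *\<^sub>R C i) *v y = (\<Sum>i\<in>I. c i *\<^sub>R (C i *v y))"
  by (induction I rule: infinite_finite_induct)
    (auto simp: matrix_vector_mult_add_rdistrib scaleR_matrix_vector_assoc)

section \<open>Block vectors, and the covariance equation tested against vectors\<close>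

definition vcat :: "real^'n \<Rightarrow> real^'m \<Rightarrow> real^('n::finite + 'm::finite)" where
  "vcat a b = (\<chi> j. case j of Inl i \<Rightarrow> a $ i | Inr i \<Rightarrow> b $ i)"

lemma vcat_nth [simp]: "vcat a b $ Inl i = a $ i" "vcat a b $ Inr j = b $ j"
  by (simp_all add: vcat_def)

lemma sum_UNIV_Plus:
  fixes f :: "'n::finite + 'm::finite \<Rightarrow> 'b::comm_monoid_add"
  shows "(\<Sum>j\<in>UNIV. f j) = (\<Sum>i\<in>UNIV. f (Inl i)) + (\<Sum>i\<in>UNIV. f (Inr i))"
  by (simp add: UNIV_Plus_UNIV [symmetric] sum.Plus del: UNIV_Plus_UNIV)

lemma inner_vcat: "vcat a b \<bullet> vcat c d = a \<bullet> c + b \<bullet> d"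
  by (simp add: inner_vec_def sum_UNIV_Plus)

lemma vcat_add: "vcat a b + vcat c d = vcat (a + c) (b + d)"
  by (simp add: vec_eq_iff vcat_def split: sum.split)

lemma norm_vcat_sq: "(norm (vcat a b))\<^sup>2 = (norm a)\<^sup>2 + (norm b)\<^sup>2"
  by (simp add: power2_norm_eq_inner inner_vcat)

lemma transpose_hcat_mult: "transpose (hcat A B) *v p = vcat (transpose A *v p) (transpose B *v p)"
  by (simp add: vec_eq_iff vcat_def hcat_def transpose_def matrix_vector_mult_def split: sum.split)

lemma transpose_Fmat_mult:
  fixes p :: "real^'n::finite"
  shows "transpose (Fmat :: real^('n + 'm::finite)^'n) *v p = vcat p 0"
proof -
  have "transpose (0 :: real^'m^'n) *v p = 0"
    by (simp add: transpose_def matrix_vector_mult_def vec_eq_iff)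
  then show ?thesis
    by (simp only: Fmat_def transpose_hcat_mult transpose_mat matrix_vector_mul_lid)
qed

text \<open>Both sides are symmetric, so by polarization it suffices to compare quadratic forms; a
  congruence by C only moves the argument p to \<open>transpose C *v p\<close>. Both directions of
  the theorem work with this scalar form.\<close>

lemma covariance_equation_iff_qform:
  fixes V :: "real^('n::finite + 'm::finite)^('n + 'm)" and A :: "real^'n^'n"
    and As :: "nat \<Rightarrow> real^'n^'n" and B :: "real^'m^'n"
  assumes sym: "transpose V = V"
  shows "Fmat ** V ** transpose Fmat =
        hcat A B ** V ** transpose (hcat A B)
        + (\<Sum>i=1..M. As i ** Fmat ** V ** transpose Fmat ** transpose (As i))
        + mat 1
    \<longleftrightarrow> (\<forall>p. qform V (vcat p 0) = qform V (vcat (transpose A *v p) (transpose B *v p))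
        + (\<Sum>i=1..M. qform V (vcat (transpose (As i) *v p) 0)) + p \<bullet> p)"
    (is "?L = ?R \<longleftrightarrow> _")
proof -
  have symC: "transpose (C ** V ** transpose C) = C ** V ** transpose C" for C :: "real^('n + 'm)^'n"
    by (simp add: matrix_transpose_mul sym matrix_mul_assoc)
  \<comment> \<open>Regrouped, each noise summand is a congruence of \<open>V\<close> by
    \<open>As i ** Fmat\<close>, so that \<open>symC\<close> and \<open>qform_congruence\<close>
    cover it too.\<close>
  have step: "As i ** Fmat ** V ** transpose Fmat ** transpose (As i)
      = (As i ** Fmat) ** V ** transpose (As i ** Fmat)" for i
    by (simp add: matrix_transpose_mul matrix_mul_assoc)
  have noise_term: "transpose (As i ** (Fmat :: real^('n + 'm)^'n)) *v p = vcat (transpose (As i) *v p) 0" for i p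
    by (simp only: matrix_transpose_mul matrix_vector_mul_assoc [symmetric] transpose_Fmat_mult)
  have "transpose ?R = ?R"
    by (simp only: step bounded_linear.linear [OF bounded_linear_transpose, THEN linear_add]
        transpose_sum symC transpose_mat)
  then have "?L = ?R \<longleftrightarrow> (\<forall>p. qform ?L p = qform ?R p)"
    using symC by (intro symmetric_eq_iff_qform) auto
  also have "\<dots> \<longleftrightarrow> (\<forall>p. qform V (vcat p 0) = qform V (vcat (transpose A *v p) (transpose B *v p))
        + (\<Sum>i=1..M. qform V (vcat (transpose (As i) *v p) 0)) + p \<bullet> p)"
    by (simp only: step qform_add qform_sum noise_term qform_congruence qform_mat_1
        transpose_hcat_mult transpose_Fmat_mult)
  finally show ?thesis .
qed

text \<open>
  With blocks \<open>X\<close>, \<open>Y\<close>, \<open>Z\<close> of \<open>V\<close>, the gain is \<open>K = Y\<^sup>T X\<^sup>-\<^sup>1\<close>, and the inequality says that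
  the Schur complement \<open>Z - Y\<^sup>T X\<^sup>-\<^sup>1 Y\<close> is positive semidefinite.
\<close>

lemma exists_gain:
  fixes V :: "real^('n::finite + 'm::finite)^('n + 'm)"
  assumes psd: "psd V" and pos: "\<And>p. p \<noteq> 0 \<Longrightarrow> 0 < qform V (vcat p 0)"
  obtains K :: "real^'n^'m"
    where "\<And>a b. qform V (vcat (a + transpose K *v b) 0) \<le> qform V (vcat a b)"
proof -
  define X :: "real^'n^'n" where "X = (\<chi> i j. V $ Inl i $ Inl j)"
  define Y :: "real^'m^'n" where "Y = (\<chi> i j. V $ Inl i $ Inr j)"
  define Z :: "real^'m^'m" where "Z = (\<chi> i j. V $ Inr i $ Inr j)"
  have sym: "transpose V = V" and nonneg: "0 \<le> qform V z" for z
    using psd by (auto simp: psd_def qform_def)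
  have entry: "V $ i $ j = V $ j $ i" for i j
    using arg_cong [OF sym, of "\<lambda>W. W $ j $ i"] by (simp add: transpose_def)
  have mult: "V *v vcat a b = vcat (X *v a + Y *v b) (transpose Y *v a + Z *v b)" for a b
    by (simp add: vec_eq_iff vcat_def matrix_vector_mult_def X_def Y_def Z_def sum_UNIV_Plus
        transpose_def entry [of "Inr i" "Inl j" for i j] split: sum.split)
  have symX: "transpose X = X"
    unfolding X_def using entry by (simp add: transpose_def vec_eq_iff)
  have form: "qform V (vcat a b) = a \<bullet> (X *v a) + 2 * (a \<bullet> (Y *v b)) + b \<bullet> (Z *v b)" for a b
  proof -
    have "b \<bullet> (transpose Y *v a) = a \<bullet> (Y *v b)"
      using inner_transpose [of Y a b] by (simp add: inner_commute)
    then show ?thesis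
      unfolding qform_def mult inner_vcat inner_add_right by simp
  qed
  \<comment> \<open>By \<open>form\<close>, p \<bullet> X p is the form of \<open>V\<close> at (p,
    0). It is positive for p \<noteq> 0, so the square matrix \<open>X\<close> has trivial kernel
    and is invertible.\<close>
  have "p = 0" if "X *v p = 0" for p
    using form [of p 0] that pos [of p] by force
  then obtain X' where X': "X' ** X = mat 1"
    using matrix_left_invertible_ker [of X] by auto
  then have X'': "X ** X' = mat 1"
    by (simp add: matrix_left_right_inverse)
  define H where "H = X' ** Y"
  have XH: "X *v (H *v b) = Y *v b" for b
    by (simp add: H_def matrix_vector_mul_assoc matrix_mul_assoc X'')
  have "qform V (vcat (a + H *v b) 0) \<le> qform V (vcat a b)" for a b
  proof -
    \<comment> \<open>At (-H b, b) the form of \<open>V\<close> is exactly this Schur complement,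
      which is also the difference between the two sides of the claimed inequality.\<close>
    have "0 \<le> b \<bullet> (Z *v b) - (H *v b) \<bullet> (Y *v b)"
      using nonneg [of "vcat (- (H *v b)) b"]
      by (simp add: form XH linear_neg [OF matrix_vector_mul_linear])
    moreover have "(H *v b) \<bullet> (X *v a) = a \<bullet> (Y *v b)"
      using inner_transpose [of X "H *v b" a] symX XH by (simp add: inner_commute)
    ultimately show ?thesis
      by (simp add: form XH matrix_vector_right_distrib inner_add_left inner_add_right)
  qed
  then show ?thesis
    by (intro that [of "transpose H"]) simp
qed

text \<open>A linear right inverse g of B on its range satisfies B (g v) = v for every v = B u; its
  matrix serves as \<open>L\<close>, whatever the rank of B.\<close>

lemma exists_generalized_inverse:
  fixes B :: "real^'m^'n"
  obtains L :: "real^'n^'m" where "\<And>u. B *v (L *v (B *v u)) = B *v u"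
proof -
  obtain g where g: "linear g" "\<And>v. v \<in> range (\<lambda>u. B *v u) \<Longrightarrow> B *v g v = v"
    using linear_exists_right_inverse_on [of "\<lambda>u. B *v u" UNIV] by auto
  have "g v = matrix g *v v" for v
    using matrix_works [OF g(1)[folded linear_matrix_vector_mul_eq]] g(1) by (simp add: matrix_works)
  then show ?thesis
    using g(2) by (intro that [of "matrix g"]) auto
qed

subsection \<open>Square integrability and second moments\<close>

lemma square_integrableD:
  assumes "square_integrable P f"
  shows "f \<in> borel_measurable P" "integrable P (\<lambda>\<omega>. (norm (f \<omega>))\<^sup>2)"
  using assms by (auto simp: square_integrable_def)

lemma square_integrable_bound:
  assumes "integrable P b" "f \<in> borel_measurable P" "\<And>\<omega>. (norm (f \<omega>))\<^sup>2 \<le> b \<omega>"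
  shows "square_integrable P f"
  unfolding square_integrable_def
proof
  show "integrable P (\<lambda>\<omega>. (norm (f \<omega>))\<^sup>2)"
  proof (rule Bochner_Integration.integrable_bound [OF assms(1)])
    show "AE \<omega> in P. norm ((norm (f \<omega>))\<^sup>2) \<le> norm (b \<omega>)"
    proof (intro AE_I2)
      show "norm ((norm (f \<omega>))\<^sup>2) \<le> norm (b \<omega>)" for \<omega>
        using assms(3) [of \<omega>] by simp
    qed
  qed (use assms(2) in measurable)
qed (fact assms(2))

lemma norm_add_sq_le:
  fixes x y :: "'b::real_inner"
  shows "(norm (x + y))\<^sup>2 \<le> 2 * (norm x)\<^sup>2 + 2 * (norm y)\<^sup>2"
  using zero_le_power2 [of "norm (x - y)"]
  by (simp add: power2_norm_eq_inner algebra_simps inner_commute)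

lemma square_integrable_add:
  assumes "square_integrable P f" "square_integrable P g"
  shows "square_integrable P (\<lambda>\<omega>. f \<omega> + g \<omega>)"
proof (rule square_integrable_bound)
  show "integrable P (\<lambda>\<omega>. 2 * (norm (f \<omega>))\<^sup>2 + 2 * (norm (g \<omega>))\<^sup>2)"
    using assms by (auto simp: square_integrable_def)
qed (use assms in \<open>auto simp: square_integrable_def norm_add_sq_le\<close>)

lemma square_integrable_zero: "square_integrable P (\<lambda>_. 0)"
  by (simp add: square_integrable_def)

lemma borel_measurable_bounded_linear:
  fixes T :: "'b::euclidean_space \<Rightarrow> 'c::euclidean_space"
  assumes "bounded_linear T" "f \<in> borel_measurable P"
  shows "(\<lambda>\<omega>. T (f \<omega>)) \<in> borel_measurable P"
proof (rule measurable_compose [OF assms(2)])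
  show "T \<in> borel_measurable borel"
    using assms(1) by (intro borel_measurable_continuous_onI linear_continuous_on)
qed

lemma borel_measurable_matrix_vector_mult:
  fixes A :: "real^'n^'m"
  shows "f \<in> borel_measurable P \<Longrightarrow> (\<lambda>\<omega>. A *v f \<omega>) \<in> borel_measurable P"
  by (rule borel_measurable_bounded_linear [OF matrix_vector_mul_bounded_linear])

lemma square_integrable_bounded_linear:
  assumes "bounded_linear T" "square_integrable P f"
  shows "square_integrable P (\<lambda>\<omega>. T (f \<omega>))"
proof -
  obtain K where K: "\<And>x. norm (T x) \<le> norm x * K"
    using bounded_linear.bounded [OF assms(1)] by blast
  show ?thesis
  proof (rule square_integrable_bound)
    show "integrable P (\<lambda>\<omega>. (norm (f \<omega>))\<^sup>2 * K\<^sup>2)"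
      using square_integrableD(2) [OF assms(2)] by simp
    show "(\<lambda>\<omega>. T (f \<omega>)) \<in> borel_measurable P"
      by (rule borel_measurable_bounded_linear [OF assms(1) square_integrableD(1) [OF assms(2)]])
    show "(norm (T (f \<omega>)))\<^sup>2 \<le> (norm (f \<omega>))\<^sup>2 * K\<^sup>2" for \<omega>
      using power_mono [OF K norm_ge_zero, of "f \<omega>" 2] by (simp add: power_mult_distrib)
  qed
qed

lemma square_integrable_matrix_vector_mult:
  fixes A :: "real^'n^'m"
  shows "square_integrable P f \<Longrightarrow> square_integrable P (\<lambda>\<omega>. A *v f \<omega>)"
  by (rule square_integrable_bounded_linear [OF matrix_vector_mul_bounded_linear])

lemma square_integrable_inner:
  "square_integrable P f \<Longrightarrow> square_integrable P (\<lambda>\<omega>. p \<bullet> f \<omega>)"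
  by (rule square_integrable_bounded_linear [OF bounded_linear_inner_right])

lemma square_integrable_vcat:
  fixes f :: "'a \<Rightarrow> real^'n" and g :: "'a \<Rightarrow> real^'m"
  assumes "square_integrable P f" "square_integrable P g"
  shows "square_integrable P (\<lambda>\<omega>. vcat (f \<omega>) (g \<omega>))"
proof -
  have eq: "vcat a b = vcat a 0 + vcat 0 b" for a :: "real^'n" and b :: "real^'m"
    by (simp add: vcat_add)
  have "linear (\<lambda>a. vcat a 0 :: real^('n+'m))" "linear (\<lambda>b. vcat 0 b :: real^('n+'m))"
    by (auto intro!: linearI simp: vec_eq_iff vcat_def split: sum.split)
  then show ?thesis
    by (subst eq) (intro square_integrable_add assms
        square_integrable_bounded_linear [where T = "\<lambda>a. vcat a 0 :: real^('n+'m)"]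
        square_integrable_bounded_linear [where T = "\<lambda>b. vcat 0 b :: real^('n+'m)"],
        auto simp: linear_conv_bounded_linear)
qed

lemma square_integrable_real_iff:
  fixes f :: "'a \<Rightarrow> real"
  shows "square_integrable P f \<longleftrightarrow> f \<in> borel_measurable P \<and> integrable P (\<lambda>\<omega>. (f \<omega>)\<^sup>2)"
  by (simp add: square_integrable_def)

lemma square_integrable_mult:
  fixes f g :: "'a \<Rightarrow> real"
  assumes "square_integrable P f" "square_integrable P g"
  shows "integrable P (\<lambda>\<omega>. f \<omega> * g \<omega>)"
proof (rule Bochner_Integration.integrable_bound)
  show "integrable P (\<lambda>\<omega>. (f \<omega>)\<^sup>2 + (g \<omega>)\<^sup>2)"
    using assms by (auto simp: square_integrable_real_iff)
  have "\<bar>a * b\<bar> \<le> \<bar>a\<^sup>2 + b\<^sup>2\<bar>" for a b :: real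
    using sum_squares_bound [of a b] sum_squares_bound [of a "- b"] by (simp add: abs_le_iff)
  then show "AE \<omega> in P. norm (f \<omega> * g \<omega>) \<le> norm ((f \<omega>)\<^sup>2 + (g \<omega>)\<^sup>2)"
    by simp
qed (use assms in \<open>auto simp: square_integrable_real_iff\<close>)

lemma norm_sq_eq_sum_Basis: "(norm x)\<^sup>2 = (\<Sum>b\<in>Basis. (b \<bullet> x)\<^sup>2)"
  unfolding power2_norm_eq_inner
  by (subst euclidean_inner) (simp add: power2_eq_square inner_commute)

text \<open>The recursion is proved for the scalars p \<bullet> x only; this lifts its integrability
  part back to the state vector.\<close>

lemma square_integrable_componentwise:
  assumes "f \<in> borel_measurable P" "\<And>b. b \<in> Basis \<Longrightarrow> square_integrable P (\<lambda>\<omega>. b \<bullet> f \<omega>)"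
  shows "square_integrable P f"
  using assms unfolding square_integrable_def norm_sq_eq_sum_Basis [of "f _"] by auto

lemma integral_norm_sq_eq_sum:
  assumes "square_integrable P f"
  shows "(\<integral>\<omega>. (norm (f \<omega>))\<^sup>2 \<partial>P) = (\<Sum>b\<in>Basis. \<integral>\<omega>. (b \<bullet> f \<omega>)\<^sup>2 \<partial>P)"
  using square_integrable_inner [OF assms]
  by (simp add: norm_sq_eq_sum_Basis Bochner_Integration.integral_sum square_integrable_real_iff)

lemma nn_integral_inner_self:
  assumes "square_integrable P f"
  shows "(\<integral>\<^sup>+ \<omega>. ennreal (f \<omega> \<bullet> f \<omega>) \<partial>P) = ennreal (\<integral>\<omega>. (norm (f \<omega>))\<^sup>2 \<partial>P)"
  using nn_integral_eq_integral [OF square_integrableD(2) [OF assms]]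
  by (simp add: power2_norm_eq_inner)

lemma square_integrable_if_nn_integral_finite:
  assumes "f \<in> borel_measurable P" "(\<integral>\<^sup>+ \<omega>. ennreal (f \<omega> \<bullet> f \<omega>) \<partial>P) < \<infinity>"
  shows "square_integrable P f"
  unfolding square_integrable_def power2_norm_eq_inner
  using assms by (auto intro!: integrableI_nonneg)

section \<open>Second-moment matrices E z z^T\<close>

definition outer_product :: "real^'n \<Rightarrow> real^'n^'n" where
  "outer_product z = (\<chi> a b. z $ a * z $ b)"

text \<open>The norm on matrices is the Euclidean one over all entries, and row a of z z^T is z_a z.
  Hence the mean square of z controls both the integrability of z z^T and the norm of its
  mean.\<close>

lemma norm_outer_product: "norm (outer_product z) = (norm z)\<^sup>2"
proof -
  have "outer_product z $ a = (z $ a) *\<^sub>R z" for a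
    by (simp add: outer_product_def vec_eq_iff)
  then have "norm (outer_product z) = L2_set (\<lambda>a. norm (z $ a) * norm z) UNIV"
    by (simp only: norm_vec_def [of "outer_product z"] norm_scaleR real_norm_def)
  also have "\<dots> = norm z * norm z"
    by (simp add: L2_set_left_distrib [symmetric] norm_vec_def)
  finally show ?thesis
    by (simp add: power2_eq_square)
qed

lemma qform_outer_product: "qform (outer_product z) p = (p \<bullet> z)\<^sup>2"
proof -
  have "outer_product z *v p = (p \<bullet> z) *\<^sub>R z"
    by (simp add: outer_product_def vec_eq_iff matrix_vector_mult_def inner_vec_def
        sum_distrib_left sum_distrib_right mult_ac)
  then show ?thesis
    by (simp add: qform_def power2_eq_square)
qed

lemma integrable_outer_product:
  assumes "square_integrable P z"
  shows "integrable P (\<lambda>\<omega>. outer_product (z \<omega>))"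
proof (rule Bochner_Integration.integrable_bound)
  show "integrable P (\<lambda>\<omega>. (norm (z \<omega>))\<^sup>2)"
    using assms by (rule square_integrableD)
  show "(\<lambda>\<omega>. outer_product (z \<omega>)) \<in> borel_measurable P"
  proof (rule measurable_compose [OF square_integrableD(1) [OF assms]])
    show "outer_product \<in> borel_measurable borel"
      unfolding outer_product_def [abs_def]
      by (intro borel_measurable_continuous_onI continuous_intros)
  qed
qed (simp add: norm_outer_product)

definition second_moment :: "'a measure \<Rightarrow> ('a \<Rightarrow> real^'n) \<Rightarrow> real^'n^'n" where
  "second_moment P z = (\<integral>\<omega>. outer_product (z \<omega>) \<partial>P)"

text \<open>For fixed p the form is a bounded linear functional of the matrix and so commutes with
  the integral.\<close>

lemma qform_second_moment:
  assumes "square_integrable P z"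
  shows "qform (second_moment P z) p = (\<integral>\<omega>. (p \<bullet> z \<omega>)\<^sup>2 \<partial>P)"
  using integral_bounded_linear [OF bounded_linear_qform integrable_outer_product [OF assms], of p]
  by (simp add: second_moment_def qform_outer_product)

lemma transpose_second_moment:
  assumes "square_integrable P z"
  shows "transpose (second_moment P z) = second_moment P z"
proof -
  have sym: "transpose (outer_product y) = outer_product y" for y :: "real^'n"
    by (simp add: outer_product_def transpose_def vec_eq_iff mult.commute)
  show ?thesis
    using integral_bounded_linear [OF bounded_linear_transpose integrable_outer_product [OF assms]]
    unfolding second_moment_def sym by (rule HOL.sym)
qed

lemma norm_second_moment_le: "norm (second_moment P z) \<le> (\<integral>\<omega>. (norm (z \<omega>))\<^sup>2 \<partial>P)"
  unfolding second_moment_def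
  using integral_norm_bound [of P "\<lambda>\<omega>. outer_product (z \<omega>)"] by (simp add: norm_outer_product)

subsection \<open>Independent noises\<close>

text \<open>
  The second-moment recursion needs each noise to be independent of everything it is multiplied
  with. The sigma-algebra generated by \<open>all\<close> other noises, past and future, serves for this purpose:
  the state at time \<open>k\<close> is measurable with respect to it because it only depends on earlier noises.
\<close>

definition noise_index :: "nat \<Rightarrow> (nat + nat \<times> nat) set" where
  "noise_index M = UNIV <+> (UNIV \<times> {1..M})"

definition noise_time :: "nat + nat \<times> nat \<Rightarrow> nat" where
  "noise_time j = (case j of Inl k \<Rightarrow> k | Inr (k, i) \<Rightarrow> k)"

lemma noise_time_simps [simp]: "noise_time (Inl k) = k" "noise_time (Inr (k, i)) = k"
  by (simp_all add: noise_time_def)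

text \<open>Stability under intersection is what carries independence from the noise events over to
  the sigma-algebras generated by groups of them.\<close>

lemma Int_stable_vimage: "Int_stable {f -` S \<inter> \<Omega> | S. S \<in> sets N}"
proof (rule Int_stableI)
  fix a b
  assume "a \<in> {f -` S \<inter> \<Omega> | S. S \<in> sets N}" "b \<in> {f -` S \<inter> \<Omega> | S. S \<in> sets N}"
  then obtain S T where "S \<in> sets N" "T \<in> sets N" and "a = f -` S \<inter> \<Omega>" "b = f -` T \<inter> \<Omega>"
    by blast
  then show "a \<inter> b \<in> {f -` S \<inter> \<Omega> | S. S \<in> sets N}"
    by (intro CollectI exI [of _ "S \<inter> T"]) auto
qed

lemma Int_stable_noise_events: "Int_stable (noise_events P w \<sigma> j)"
  by (cases "(P, w, \<sigma>, j)" rule: noise_events.cases) (simp_all add: Int_stable_vimage)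

lemma measurable_sigma_vimage:
  assumes "G \<subseteq> Pow \<Omega>" "{f -` S \<inter> \<Omega> | S. S \<in> sets N} \<subseteq> G" "space N = UNIV"
  shows "f \<in> measurable (sigma \<Omega> G) N"
proof (rule measurableI)
  fix S
  assume "S \<in> sets N"
  then have "f -` S \<inter> \<Omega> \<in> G"
    using assms(2) by blast
  then show "f -` S \<inter> space (sigma \<Omega> G) \<in> sets (sigma \<Omega> G)"
    using assms(1) by (simp add: sets_measure_of space_measure_of)
qed (simp add: assms)

locale noise_process = prob_space P for P :: "'a measure" +
  fixes M :: nat and w :: "nat \<Rightarrow> 'a \<Rightarrow> real^'n" and \<sigma> :: "nat \<Rightarrow> nat \<Rightarrow> 'a \<Rightarrow> real"
  assumes square_integrable_w: "square_integrable P (w k)"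
    and square_integrable_\<sigma>: "i \<in> {1..M} \<Longrightarrow> square_integrable P (\<sigma> k i)"
    and mean_w: "(\<integral>\<omega>. w k \<omega> \<partial>P) = 0"
    and mean_\<sigma>: "i \<in> {1..M} \<Longrightarrow> (\<integral>\<omega>. \<sigma> k i \<omega> \<partial>P) = 0"
    and independent: "mutually_independent P M w \<sigma>"
    and second_moment_w: "second_moment P (w k) = mat 1"
    and second_moment_\<sigma>: "i \<in> {1..M} \<Longrightarrow> (\<integral>\<omega>. (\<sigma> k i \<omega>)\<^sup>2 \<partial>P) = 1"
begin

definition own_noise :: "nat + nat \<times> nat \<Rightarrow> 'a measure" where
  "own_noise j = sigma (space P) (noise_events P w \<sigma> j)"

definition other_noises :: "nat + nat \<times> nat \<Rightarrow> 'a measure" where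
  "other_noises j = sigma (space P) (\<Union>i\<in>noise_index M - {j}. noise_events P w \<sigma> i)"

lemma indep_noise_events: "indep_sets (noise_events P w \<sigma>) (noise_index M)"
  using independent by (simp add: mutually_independent_def noise_index_def)

lemma noise_events_subset: "noise_events P w \<sigma> j \<subseteq> Pow (space P)"
  by (cases "(P, w, \<sigma>, j)" rule: noise_events.cases) auto

lemma space_own_noise [simp]: "space (own_noise j) = space P"
  and space_other_noises [simp]: "space (other_noises j) = space P"
  and sets_own_noise: "sets (own_noise j) = sigma_sets (space P) (noise_events P w \<sigma> j)"
  and sets_other_noises: "sets (other_noises j)
    = sigma_sets (space P) (\<Union>i\<in>noise_index M - {j}. noise_events P w \<sigma> i)"
  using noise_events_subset
  by (simp_all add: own_noise_def other_noises_def UN_subset_iff space_measure_of_conv sets_measure_of)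

text \<open>The index set splits into the disjoint blocks {j} and the rest, and independent
  intersection-stable families remain independent when grouped into disjoint blocks.\<close>

lemma indep_set_noise:
  assumes "j \<in> noise_index M"
  shows "indep_set (sets (other_noises j)) (sets (own_noise j))"
proof -
  have "indep_sets (\<lambda>b. sigma_sets (space P)
      (\<Union>i\<in>case_bool (noise_index M - {j}) {j} b. noise_events P w \<sigma> i)) UNIV"
  proof (rule indep_sets_collect_sigma)
    have "(\<Union>b. case_bool (noise_index M - {j}) {j} b) = noise_index M"
      using assms by (auto simp: UNIV_bool)
    then show "indep_sets (noise_events P w \<sigma>) (\<Union>b. case_bool (noise_index M - {j}) {j} b)"
      using indep_noise_events by simp
    show "disjoint_family (case_bool (noise_index M - {j}) {j})"
      by (auto simp: disjoint_family_on_def split: bool.splits)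
  qed (rule Int_stable_noise_events)
  moreover have "(\<lambda>b. sigma_sets (space P)
      (\<Union>i\<in>case_bool (noise_index M - {j}) {j} b. noise_events P w \<sigma> i))
      = case_bool (sets (other_noises j)) (sets (own_noise j))"
    by (rule ext) (simp add: sets_other_noises sets_own_noise split: bool.split)
  ultimately show ?thesis
    by (simp add: indep_set_def)
qed

text \<open>Independence of set systems includes the requirement that they consist of events of
  \<open>P\<close>.\<close>

lemma subalgebra_noise:
  assumes "j \<in> noise_index M"
  shows "subalgebra P (other_noises j)" "subalgebra P (own_noise j)"
  using indep_set_noise [OF assms] by (auto simp: subalgebra_def indep_set_def indep_sets_def UNIV_bool)

text \<open>The sigma-algebras generated by \<open>X\<close> and \<open>Y\<close> lie inside the two
  independent ones, so \<open>X\<close> and \<open>Y\<close> are independent random variables and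
  the expectation of their product factors.\<close>

lemma
  fixes X Y :: "'a \<Rightarrow> real"
  assumes j: "j \<in> noise_index M"
    and X: "X \<in> borel_measurable (other_noises j)" "integrable P X"
    and Y: "Y \<in> borel_measurable (own_noise j)" "integrable P Y"
  shows integrable_mult_noise: "integrable P (\<lambda>\<omega>. X \<omega> * Y \<omega>)"
    and integral_mult_noise: "(\<integral>\<omega>. X \<omega> * Y \<omega> \<partial>P) = (\<integral>\<omega>. X \<omega> \<partial>P) * (\<integral>\<omega>. Y \<omega> \<partial>P)"
proof -
  have sub: "sigma_sets (space P) {Z -` S \<inter> space P | S. S \<in> sets borel} \<subseteq> sets N"
    if "Z \<in> borel_measurable N" "space N = space P" for Z :: "'a \<Rightarrow> real" and N
  proof -
    have "{Z -` S \<inter> space N | S. S \<in> sets borel} \<subseteq> sets N"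
      using that(1) by (auto intro: measurable_sets)
    then show ?thesis
      using sets.sigma_sets_subset [of _ N] that(2) by simp
  qed
  have "indep_set (sigma_sets (space P) {X -` S \<inter> space P | S. S \<in> sets borel})
      (sigma_sets (space P) {Y -` S \<inter> space P | S. S \<in> sets borel})"
    unfolding indep_set_def
    by (rule indep_sets_mono_sets [OF indep_set_noise [OF j, unfolded indep_set_def]])
      (use sub [OF X(1)] sub [OF Y(1)] in \<open>auto split: bool.split\<close>)
  then have "indep_var borel X borel Y"
    unfolding indep_var_eq using X(2) Y(2) by auto
  then show "integrable P (\<lambda>\<omega>. X \<omega> * Y \<omega>)"
    "(\<integral>\<omega>. X \<omega> * Y \<omega> \<partial>P) = (\<integral>\<omega>. X \<omega> \<partial>P) * (\<integral>\<omega>. Y \<omega> \<partial>P)"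
    using X(2) Y(2) by (auto intro: indep_var_integrable indep_var_lebesgue_integral)
qed

lemma
  fixes h g \<xi> :: "'a \<Rightarrow> real"
  assumes j: "j \<in> noise_index M"
    and hg: "h \<in> borel_measurable (other_noises j)" "g \<in> borel_measurable (other_noises j)"
    and \<xi>: "\<xi> \<in> borel_measurable (own_noise j)" "(\<integral>\<omega>. \<xi> \<omega> \<partial>P) = 0"
    and sq: "square_integrable P h" "square_integrable P g" "square_integrable P \<xi>"
  shows square_integrable_add_noise: "square_integrable P (\<lambda>\<omega>. h \<omega> + \<xi> \<omega> * g \<omega>)"
    and integral_sq_add_noise: "(\<integral>\<omega>. (h \<omega> + \<xi> \<omega> * g \<omega>)\<^sup>2 \<partial>P)
      = (\<integral>\<omega>. (h \<omega>)\<^sup>2 \<partial>P) + (\<integral>\<omega>. (\<xi> \<omega>)\<^sup>2 \<partial>P) * (\<integral>\<omega>. (g \<omega>)\<^sup>2 \<partial>P)"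
proof -
  have int: "integrable P (\<lambda>\<omega>. (h \<omega>)\<^sup>2)" "integrable P (\<lambda>\<omega>. (g \<omega>)\<^sup>2)" "integrable P (\<lambda>\<omega>. (\<xi> \<omega>)\<^sup>2)"
      "integrable P (\<lambda>\<omega>. h \<omega> * g \<omega>)" "integrable P \<xi>"
    \<comment> \<open>Pairing \<open>\<xi>\<close> with the constant 1, which is square integrable
      on a probability space, shows that \<open>\<xi>\<close> itself is integrable.\<close>
    using sq square_integrable_mult [of P h g] square_integrable_mult [of P \<xi> "\<lambda>_. 1"]
    by (auto simp: square_integrable_real_iff)
  have "integrable P (\<lambda>\<omega>. (g \<omega>)\<^sup>2 * (\<xi> \<omega>)\<^sup>2)"
      "(\<integral>\<omega>. (g \<omega>)\<^sup>2 * (\<xi> \<omega>)\<^sup>2 \<partial>P) = (\<integral>\<omega>. (g \<omega>)\<^sup>2 \<partial>P) * (\<integral>\<omega>. (\<xi> \<omega>)\<^sup>2 \<partial>P)"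
      "integrable P (\<lambda>\<omega>. h \<omega> * g \<omega> * \<xi> \<omega>)" "(\<integral>\<omega>. h \<omega> * g \<omega> * \<xi> \<omega> \<partial>P) = 0"
    using integral_mult_noise [OF j, of "\<lambda>\<omega>. h \<omega> * g \<omega>" \<xi>] int hg \<xi>
    by (auto intro!: integrable_mult_noise [OF j] integral_mult_noise [OF j])
  note parts = this
  have eq: "(h \<omega> + \<xi> \<omega> * g \<omega>)\<^sup>2 = (h \<omega>)\<^sup>2 + 2 * (h \<omega> * g \<omega> * \<xi> \<omega>) + (g \<omega>)\<^sup>2 * (\<xi> \<omega>)\<^sup>2" for \<omega>
    by (simp add: power2_eq_square algebra_simps)
  show "square_integrable P (\<lambda>\<omega>. h \<omega> + \<xi> \<omega> * g \<omega>)"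
    unfolding square_integrable_real_iff eq
    using sq int parts by (auto simp: square_integrable_real_iff)
  show "(\<integral>\<omega>. (h \<omega> + \<xi> \<omega> * g \<omega>)\<^sup>2 \<partial>P)
      = (\<integral>\<omega>. (h \<omega>)\<^sup>2 \<partial>P) + (\<integral>\<omega>. (\<xi> \<omega>)\<^sup>2 \<partial>P) * (\<integral>\<omega>. (g \<omega>)\<^sup>2 \<partial>P)"
    unfolding eq using int parts by simp
qed

lemma measurable_own_noise:
  shows "w k \<in> borel_measurable (own_noise (Inl k))"
    and "\<sigma> k i \<in> borel_measurable (own_noise (Inr (k, i)))"
  unfolding own_noise_def
  by (rule measurable_sigma_vimage [OF noise_events_subset], simp, simp)+

lemma measurable_other_noises:
  shows "j \<noteq> Inl k \<Longrightarrow> w k \<in> borel_measurable (other_noises j)"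
    and "i \<in> {1..M} \<Longrightarrow> j \<noteq> Inr (k, i) \<Longrightarrow> \<sigma> k i \<in> borel_measurable (other_noises j)"
proof -
  have sub: "(\<Union>i\<in>noise_index M - {j}. noise_events P w \<sigma> i) \<subseteq> Pow (space P)"
    using noise_events_subset by blast
  show "w k \<in> borel_measurable (other_noises j)" if "j \<noteq> Inl k"
    unfolding other_noises_def
  proof (rule measurable_sigma_vimage [OF sub])
    have "Inl k \<in> noise_index M - {j}"
      using that by (auto simp: noise_index_def)
    then show "{w k -` S \<inter> space P | S. S \<in> sets borel}
        \<subseteq> (\<Union>i\<in>noise_index M - {j}. noise_events P w \<sigma> i)"
      using UN_upper [of "Inl k" "noise_index M - {j}" "noise_events P w \<sigma>"] by simp
  qed simp
  show "\<sigma> k i \<in> borel_measurable (other_noises j)" if "i \<in> {1..M}" "j \<noteq> Inr (k, i)"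
    unfolding other_noises_def
  proof (rule measurable_sigma_vimage [OF sub])
    have "Inr (k, i) \<in> noise_index M - {j}"
      using that by (auto simp: noise_index_def)
    then show "{\<sigma> k i -` S \<inter> space P | S. S \<in> sets borel}
        \<subseteq> (\<Union>i\<in>noise_index M - {j}. noise_events P w \<sigma> i)"
      using UN_upper [of "Inr (k, i)" "noise_index M - {j}" "noise_events P w \<sigma>"] by simp
  qed simp
qed

text \<open>The noises of time k are added one at a time. The partial sum over I involves only
  \<open>\<sigma> k i'\<close> with i' in I, so for a new index i it is measurable with respect to
  the noises other than \<open>Inr (k, i)\<close>, and the Pythagorean identity applies.\<close>

lemma noise_sum:
  fixes f :: "'a \<Rightarrow> real" and g :: "nat \<Rightarrow> 'a \<Rightarrow> real"
  assumes meas: "\<And>j. noise_time j = k \<Longrightarrow> f \<in> borel_measurable (other_noises j)"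
      "\<And>j i. noise_time j = k \<Longrightarrow> g i \<in> borel_measurable (other_noises j)"
    and sq: "square_integrable P f" "\<And>i. square_integrable P (g i)"
    and I: "I \<subseteq> {1..M}"
  shows "square_integrable P (\<lambda>\<omega>. f \<omega> + (\<Sum>i\<in>I. \<sigma> k i \<omega> * g i \<omega>)) \<and>
    (\<integral>\<omega>. (f \<omega> + (\<Sum>i\<in>I. \<sigma> k i \<omega> * g i \<omega>))\<^sup>2 \<partial>P)
      = (\<integral>\<omega>. (f \<omega>)\<^sup>2 \<partial>P) + (\<Sum>i\<in>I. \<integral>\<omega>. (g i \<omega>)\<^sup>2 \<partial>P)"
  using finite_subset [OF I finite_atLeastAtMost] I
proof (induction I rule: finite_induct)
  case empty
  show ?case
    using sq by simp
next
  case (insert i I)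
  define h where "h = (\<lambda>\<omega>. f \<omega> + (\<Sum>i\<in>I. \<sigma> k i \<omega> * g i \<omega>))"
  have sq_h: "square_integrable P h"
    and int_h: "(\<integral>\<omega>. (h \<omega>)\<^sup>2 \<partial>P) = (\<integral>\<omega>. (f \<omega>)\<^sup>2 \<partial>P) + (\<Sum>i\<in>I. \<integral>\<omega>. (g i \<omega>)\<^sup>2 \<partial>P)"
    using insert by (auto simp: h_def)
  let ?j = "Inr (k, i)"
  have j: "?j \<in> noise_index M"
    using insert by (auto simp: noise_index_def)
  have h: "h \<in> borel_measurable (other_noises ?j)"
    unfolding h_def using insert
    by (intro borel_measurable_add borel_measurable_sum borel_measurable_times meas
        measurable_other_noises) auto
  have eq: "f \<omega> + (\<Sum>i\<in>insert i I. \<sigma> k i \<omega> * g i \<omega>) = h \<omega> + \<sigma> k i \<omega> * g i \<omega>" for \<omega>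
    using insert by (simp add: h_def)
  have "i \<in> {1..M}"
    using insert by simp
  note step = j h meas(2) [of ?j i, simplified] measurable_own_noise(2)
    mean_\<sigma> [OF this] sq_h sq(2) square_integrable_\<sigma> [OF this]
  show ?case
    unfolding eq
    using square_integrable_add_noise [OF step] integral_sq_add_noise [OF step] int_h insert
    by (simp add: second_moment_\<sigma>)
qed

text \<open>The scalar p \<bullet> x splits into the part \<open>f\<close> free of time-k noise, the
  multiplicative noises with coefficients \<open>g i\<close>, and the additive noise.
  \<open>noise_sum\<close> handles the first two, one more Pythagorean step the last; the identity
  covariance of \<open>w k\<close> gives the term p \<bullet> p.\<close>

lemma
  fixes A :: "real^'n^'n" and As :: "nat \<Rightarrow> real^'n^'n" and B :: "real^'m^'n"
  assumes traj: "system_trajectory P M A As B w \<sigma> x u"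
    and meas: "\<And>j. noise_time j = k \<Longrightarrow> x k \<in> borel_measurable (other_noises j)"
      "\<And>j. noise_time j = k \<Longrightarrow> u k \<in> borel_measurable (other_noises j)"
    and sq: "square_integrable P (x k)" "square_integrable P (u k)"
  shows square_integrable_inner_Suc: "square_integrable P (\<lambda>\<omega>. p \<bullet> x (Suc k) \<omega>)"
    and second_moment_Suc: "(\<integral>\<omega>. (p \<bullet> x (Suc k) \<omega>)\<^sup>2 \<partial>P)
      = (\<integral>\<omega>. (p \<bullet> (A *v x k \<omega> + B *v u k \<omega>))\<^sup>2 \<partial>P)
        + (\<Sum>i=1..M. \<integral>\<omega>. (p \<bullet> (As i *v x k \<omega>))\<^sup>2 \<partial>P) + p \<bullet> p"
proof -
  define f where "f = (\<lambda>\<omega>. p \<bullet> (A *v x k \<omega> + B *v u k \<omega>))"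
  define g where "g = (\<lambda>i \<omega>. p \<bullet> (As i *v x k \<omega>))"
  define h where "h = (\<lambda>\<omega>. f \<omega> + (\<Sum>i=1..M. \<sigma> k i \<omega> * g i \<omega>))"
  have meas_f: "f \<in> borel_measurable (other_noises j)" if "noise_time j = k" for j
    unfolding f_def using meas [OF that]
    by (intro borel_measurable_inner borel_measurable_const borel_measurable_add
        borel_measurable_matrix_vector_mult)
  have meas_g: "g i \<in> borel_measurable (other_noises j)" if "noise_time j = k" for i j
    unfolding g_def using meas [OF that]
    by (intro borel_measurable_inner borel_measurable_const borel_measurable_matrix_vector_mult)
  have sq_fg: "square_integrable P f" "square_integrable P (g i)" for i
    unfolding f_def g_def using sq
    by (auto intro!: square_integrable_inner square_integrable_add square_integrable_matrix_vector_mult)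
  have sq_h: "square_integrable P h" and int_h: "(\<integral>\<omega>. (h \<omega>)\<^sup>2 \<partial>P)
      = (\<integral>\<omega>. (f \<omega>)\<^sup>2 \<partial>P) + (\<Sum>i=1..M. \<integral>\<omega>. (g i \<omega>)\<^sup>2 \<partial>P)"
    unfolding h_def using noise_sum [OF meas_f meas_g sq_fg order_refl] by auto
  have meas_h: "h \<in> borel_measurable (other_noises (Inl k))"
    unfolding h_def
    by (intro borel_measurable_add borel_measurable_sum borel_measurable_times meas_f meas_g
        measurable_other_noises) auto
  \<comment> \<open>The factor 1 brings the sum into the shape \<open>h + \<xi> * g\<close> of
    \<open>integral_sq_add_noise\<close>, with g constantly 1.\<close>
  have eq: "p \<bullet> x (Suc k) \<omega> = h \<omega> + (p \<bullet> w k \<omega>) * 1" if "\<omega> \<in> space P" for \<omega>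
  proof -
    have "x (Suc k) \<omega> = (A + (\<Sum>i=1..M. \<sigma> k i \<omega> *\<^sub>R As i)) *v x k \<omega> + B *v u k \<omega> + w k \<omega>"
      using traj that by (simp add: system_trajectory_def)
    then show ?thesis
      by (simp add: h_def f_def g_def matrix_vector_mult_add_rdistrib
          sum_scaleR_matrix_vector_mult inner_add_right
          inner_sum_right)
  qed
  have noise: "(\<integral>\<omega>. p \<bullet> w k \<omega> \<partial>P) = 0"
  proof -
    have "integrable P (w k)"
    proof (rule Bochner_Integration.integrable_bound)
      show "integrable P (\<lambda>\<omega>. 1 + (norm (w k \<omega>))\<^sup>2)"
        using square_integrable_w [of k] by (simp add: square_integrable_def)
      have "r \<le> 1 + r\<^sup>2" if "0 \<le> r" for r :: real
        using sum_squares_bound [of r 1] that by simp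
      then show "AE \<omega> in P. norm (w k \<omega>) \<le> norm (1 + (norm (w k \<omega>))\<^sup>2)"
        by simp
    qed (use square_integrable_w [of k] in \<open>simp add: square_integrable_def\<close>)
    then show ?thesis
      by (simp add: mean_w)
  qed
  have "(\<lambda>\<omega>. p \<bullet> w k \<omega>) \<in> borel_measurable (own_noise (Inl k))"
    by (intro borel_measurable_inner borel_measurable_const measurable_own_noise)
  moreover have "square_integrable P (\<lambda>_. 1 :: real)"
    by (simp add: square_integrable_def)
  ultimately have step: "Inl k \<in> noise_index M" "h \<in> borel_measurable (other_noises (Inl k))"
    "(\<lambda>_. 1 :: real) \<in> borel_measurable (other_noises (Inl k))"
    "(\<lambda>\<omega>. p \<bullet> w k \<omega>) \<in> borel_measurable (own_noise (Inl k))" "(\<integral>\<omega>. p \<bullet> w k \<omega> \<partial>P) = 0"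
    "square_integrable P h" "square_integrable P (\<lambda>_. 1 :: real)"
    "square_integrable P (\<lambda>\<omega>. p \<bullet> w k \<omega>)"
    using meas_h noise sq_h square_integrable_inner [OF square_integrable_w]
    by (auto simp: noise_index_def)
  have var: "(\<integral>\<omega>. (p \<bullet> w k \<omega>)\<^sup>2 \<partial>P) = p \<bullet> p"
    using qform_second_moment [OF square_integrable_w, of k p]
    by (simp add: second_moment_w qform_mat_1)
  \<comment> \<open>The state equation is only known on \<open>space P\<close>, so measurability,
    integrability and the integral are transferred by congruence.\<close>
  have meas_eq: "(\<lambda>\<omega>. p \<bullet> x (Suc k) \<omega>) \<in> borel_measurable P
      \<longleftrightarrow> (\<lambda>\<omega>. h \<omega> + (p \<bullet> w k \<omega>) * 1) \<in> borel_measurable P"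
    by (rule measurable_cong) (rule eq)
  have int_eq: "integrable P (\<lambda>\<omega>. (p \<bullet> x (Suc k) \<omega>)\<^sup>2)
      \<longleftrightarrow> integrable P (\<lambda>\<omega>. (h \<omega> + (p \<bullet> w k \<omega>) * 1)\<^sup>2)"
    by (rule Bochner_Integration.integrable_cong) (simp_all add: eq)
  show "square_integrable P (\<lambda>\<omega>. p \<bullet> x (Suc k) \<omega>)"
    using square_integrable_add_noise [OF step]
    unfolding square_integrable_real_iff meas_eq int_eq .
  have "(\<integral>\<omega>. (p \<bullet> x (Suc k) \<omega>)\<^sup>2 \<partial>P) = (\<integral>\<omega>. (h \<omega> + (p \<bullet> w k \<omega>) * 1)\<^sup>2 \<partial>P)"
    by (rule Bochner_Integration.integral_cong) (simp_all add: eq)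
  also have "\<dots> = (\<integral>\<omega>. (h \<omega>)\<^sup>2 \<partial>P) + p \<bullet> p"
    using integral_sq_add_noise [OF step] by (simp add: var prob_space)
  finally show "(\<integral>\<omega>. (p \<bullet> x (Suc k) \<omega>)\<^sup>2 \<partial>P)
      = (\<integral>\<omega>. (p \<bullet> (A *v x k \<omega> + B *v u k \<omega>))\<^sup>2 \<partial>P)
        + (\<Sum>i=1..M. \<integral>\<omega>. (p \<bullet> (As i *v x k \<omega>))\<^sup>2 \<partial>P) + p \<bullet> p"
    by (simp add: int_h f_def g_def)
qed

section \<open>Closed-loop trajectories\<close>

lemma measurable_feedback:
  assumes "causal_controller \<mu>" "\<And>l. l \<le> k \<Longrightarrow> x l \<in> borel_measurable N"
  shows "feedback \<mu> x k \<in> borel_measurable N"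
proof -
  have "(\<lambda>\<omega>. \<lambda>j\<in>{..k}. x j \<omega>) \<in> measurable N (\<Pi>\<^sub>M j\<in>{..k}. borel)"
    using assms(2) by (intro measurable_restrict) auto
  moreover have "\<mu> k \<in> borel_measurable (\<Pi>\<^sub>M j\<in>{..k}. borel)"
    using assms(1) by (simp add: causal_controller_def)
  ultimately show ?thesis
    unfolding feedback_def [abs_def] by (rule measurable_compose)
qed

text \<open>The step to time l + 1 brings in noises of time l only, and l + 1 \<le>
  \<open>noise_time j\<close> keeps all of them different from j. The case k =
  \<open>noise_time j\<close> is the one the recursion needs. Strong induction is used because the
  feedback reads the whole history.\<close>

lemma measurable_state:
  fixes A :: "real^'n^'n" and As :: "nat \<Rightarrow> real^'n^'n" and B :: "real^'m^'n"
  assumes traj: "system_trajectory P M A As B w \<sigma> x (feedback \<mu> x)"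
    and \<mu>: "causal_controller \<mu>" and "k \<le> noise_time j"
  shows "x k \<in> borel_measurable (other_noises j)"
  using assms(3)
proof (induction k rule: less_induct)
  case (less k)
  show ?case
  proof (cases k)
    case 0
    have "x 0 \<in> borel_measurable (other_noises j) \<longleftrightarrow> (\<lambda>_. 0 :: real^'n) \<in> borel_measurable (other_noises j)"
      using traj by (intro measurable_cong) (auto simp: system_trajectory_def)
    then show ?thesis
      by (simp add: 0)
  next
    case (Suc l)
    have x: "x i \<in> borel_measurable (other_noises j)" if "i \<le> l" for i
      using that less Suc by simp
    have "j \<noteq> Inl l" "j \<noteq> Inr (l, i)" for i
      using less.prems Suc by auto
    then have noise: "w l \<in> borel_measurable (other_noises j)"
      "i \<in> {1..M} \<Longrightarrow> \<sigma> l i \<in> borel_measurable (other_noises j)" for i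
      using measurable_other_noises by auto
    have "x (Suc l) \<in> borel_measurable (other_noises j) \<longleftrightarrow>
      (\<lambda>\<omega>. (A *v x l \<omega> + (\<Sum>i=1..M. \<sigma> l i \<omega> *\<^sub>R (As i *v x l \<omega>))) + B *v feedback \<mu> x l \<omega> + w l \<omega>)
        \<in> borel_measurable (other_noises j)"
    proof (rule measurable_cong)
      fix \<omega>
      assume "\<omega> \<in> space (other_noises j)"
      then show "x (Suc l) \<omega> = (A *v x l \<omega> + (\<Sum>i=1..M. \<sigma> l i \<omega> *\<^sub>R (As i *v x l \<omega>)))
          + B *v feedback \<mu> x l \<omega> + w l \<omega>"
        using traj by (simp add: system_trajectory_def matrix_vector_mult_add_rdistrib
            sum_scaleR_matrix_vector_mult)
    qed
    moreover have "(\<lambda>\<omega>. (A *v x l \<omega> + (\<Sum>i=1..M. \<sigma> l i \<omega> *\<^sub>R (As i *v x l \<omega>)))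
        + B *v feedback \<mu> x l \<omega> + w l \<omega>) \<in> borel_measurable (other_noises j)"
      using x noise measurable_feedback [OF \<mu> x]
      by (intro borel_measurable_add borel_measurable_sum borel_measurable_scaleR
          borel_measurable_matrix_vector_mult) auto
    ultimately show ?thesis
      by (simp add: Suc)
  qed
qed

lemma state_second_moments:
  fixes A :: "real^'n^'n" and As :: "nat \<Rightarrow> real^'n^'n" and B :: "real^'m^'n"
  assumes traj: "system_trajectory P M A As B w \<sigma> x (feedback \<mu> x)"
    and \<mu>: "causal_controller \<mu>"
  shows "x k \<in> borel_measurable P"
    and "square_integrable P (x k) \<Longrightarrow> square_integrable P (feedback \<mu> x k) \<Longrightarrow> square_integrable P (x (Suc k))"
    and "square_integrable P (x k) \<Longrightarrow> square_integrable P (feedback \<mu> x k) \<Longrightarrow>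
      (\<integral>\<omega>. (p \<bullet> x (Suc k) \<omega>)\<^sup>2 \<partial>P)
      = (\<integral>\<omega>. (p \<bullet> (A *v x k \<omega> + B *v feedback \<mu> x k \<omega>))\<^sup>2 \<partial>P)
        + (\<Sum>i=1..M. \<integral>\<omega>. (p \<bullet> (As i *v x k \<omega>))\<^sup>2 \<partial>P) + p \<bullet> p"
proof -
  have meas: "x k \<in> borel_measurable P" for k
  proof (rule measurable_from_subalg)
    \<comment> \<open>Any noise of time at least k would do; \<open>Inl k\<close> is an index even
      when M = 0.\<close>
    show "subalgebra P (other_noises (Inl k))"
      by (rule subalgebra_noise) (auto simp: noise_index_def)
    show "x k \<in> borel_measurable (other_noises (Inl k))"
      by (rule measurable_state [OF traj \<mu>]) simp
  qed
  then show "x k \<in> borel_measurable P" .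
  have x: "x k \<in> borel_measurable (other_noises j)" if "noise_time j = k" for j
    using measurable_state [OF traj \<mu>] that by simp
  have u: "feedback \<mu> x k \<in> borel_measurable (other_noises j)" if "noise_time j = k" for j
    using measurable_state [OF traj \<mu>] that by (intro measurable_feedback [OF \<mu>]) simp
  assume sq: "square_integrable P (x k)" "square_integrable P (feedback \<mu> x k)"
  show "square_integrable P (x (Suc k))"
    by (rule square_integrable_componentwise [OF meas])
      (rule square_integrable_inner_Suc [OF traj x u sq])
  show "(\<integral>\<omega>. (p \<bullet> x (Suc k) \<omega>)\<^sup>2 \<partial>P)
      = (\<integral>\<omega>. (p \<bullet> (A *v x k \<omega> + B *v feedback \<mu> x k \<omega>))\<^sup>2 \<partial>P)
        + (\<Sum>i=1..M. \<integral>\<omega>. (p \<bullet> (As i *v x k \<omega>))\<^sup>2 \<partial>P) + p \<bullet> p"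
    by (rule second_moment_Suc [OF traj x u sq])
qed

subsection \<open>Stabilizability and the covariance equation\<close>

text \<open>The right-hand side of the moment recursion is monotone in the second moment of the
  state, and by \<open>exists_gain\<close> the form of \<open>V\<close> on vectors (p, 0) is a
  supersolution for u = K x. The zero initial state starts below it, so all later states stay below
  it.\<close>

lemma stabilizable_if_covariance:
  fixes A :: "real^'n^'n" and As :: "nat \<Rightarrow> real^'n^'n" and B :: "real^'m^'n"
    and V :: "real^('n + 'm)^('n + 'm)"
  assumes psd: "psd V"
    and eq: "\<And>p. qform V (vcat p 0) = qform V (vcat (transpose A *v p) (transpose B *v p))
        + (\<Sum>i=1..M. qform V (vcat (transpose (As i) *v p) 0)) + p \<bullet> p"
  shows "mean_square_stabilizable P M A As B w \<sigma>"
proof -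
  have nonneg: "0 \<le> qform V z" for z
    using psd by (simp add: psd_def qform_def)
  \<comment> \<open>The summand p \<bullet> p, contributed by the additive noise, makes the state
    block of \<open>V\<close> positive definite.\<close>
  have "0 < qform V (vcat p 0)" if "p \<noteq> 0" for p
  proof -
    have "0 < p \<bullet> p"
      using that by simp
    then show ?thesis
      unfolding eq [of p] by (intro add_nonneg_pos add_nonneg_nonneg sum_nonneg nonneg)
  qed
  then obtain K :: "real^'n^'m"
    where K: "\<And>a b. qform V (vcat (a + transpose K *v b) 0) \<le> qform V (vcat a b)"
    using exists_gain [OF psd] by blast
  define \<mu> :: "nat \<Rightarrow> (nat \<Rightarrow> real^'n) \<Rightarrow> real^'m" where "\<mu> = (\<lambda>k h. K *v h k)"
  define x where "x = rec_nat (\<lambda>\<omega>. 0) (\<lambda>k y \<omega>. (A + (\<Sum>i=1..M. \<sigma> k i \<omega> *\<^sub>R As i)) *v y \<omega>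
      + B *v (K *v y \<omega>) + w k \<omega>)"
  have u: "feedback \<mu> x k = (\<lambda>\<omega>. K *v x k \<omega>)" for k
    by (simp add: feedback_def \<mu>_def fun_eq_iff)
  have \<mu>: "causal_controller \<mu>"
    unfolding causal_controller_def \<mu>_def
    by (intro allI borel_measurable_matrix_vector_mult measurable_component_singleton) simp
  have traj: "system_trajectory P M A As B w \<sigma> x (feedback \<mu> x)"
    unfolding system_trajectory_def u by (simp add: x_def)
  have state: "square_integrable P (x k) \<and> (\<forall>p. (\<integral>\<omega>. (p \<bullet> x k \<omega>)\<^sup>2 \<partial>P) \<le> qform V (vcat p 0))" for k
  proof (induction k)
    case 0
    then show ?case
      by (simp add: x_def square_integrable_zero nonneg)
  next
    case (Suc k)
    then have sq: "square_integrable P (x k)" "square_integrable P (feedback \<mu> x k)"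
      and le: "(\<integral>\<omega>. (p \<bullet> x k \<omega>)\<^sup>2 \<partial>P) \<le> qform V (vcat p 0)" for p
      unfolding u by (auto intro: square_integrable_matrix_vector_mult)
    have "(\<integral>\<omega>. (p \<bullet> x (Suc k) \<omega>)\<^sup>2 \<partial>P) \<le> qform V (vcat p 0)" for p
    proof -
      \<comment> \<open>Moved onto p, the closed-loop map A + B K yields the vector a + K^T b with a
        = A^T p and b = B^T p, which is the argument in \<open>K\<close>.\<close>
      have "p \<bullet> (A *v y + B *v (K *v y))
          = (transpose A *v p + transpose K *v (transpose B *v p)) \<bullet> y" for y
        by (simp only: inner_add_left inner_add_right inner_transpose)
      then have "(\<integral>\<omega>. (p \<bullet> (A *v x k \<omega> + B *v feedback \<mu> x k \<omega>))\<^sup>2 \<partial>P)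
          \<le> qform V (vcat (transpose A *v p + transpose K *v (transpose B *v p)) 0)"
        using le by (simp only: u)
      also have "\<dots> \<le> qform V (vcat (transpose A *v p) (transpose B *v p))"
        by (rule K)
      finally have "(\<integral>\<omega>. (p \<bullet> (A *v x k \<omega> + B *v feedback \<mu> x k \<omega>))\<^sup>2 \<partial>P)
          \<le> qform V (vcat (transpose A *v p) (transpose B *v p))" .
      moreover have "(\<integral>\<omega>. (p \<bullet> (As i *v x k \<omega>))\<^sup>2 \<partial>P) \<le> qform V (vcat (transpose (As i) *v p) 0)" for i
        using le [of "transpose (As i) *v p"] by (simp only: inner_transpose)
      ultimately show ?thesis
        unfolding state_second_moments(3) [OF traj \<mu> sq] eq [of p]
        by (intro add_mono sum_mono) simp_all
    qed
    then show ?case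
      using state_second_moments(2) [OF traj \<mu> sq] by blast
  qed
  \<comment> \<open>Summing over the basis vectors gives the trace of the state block of
    \<open>V\<close>, a bound independent of k.\<close>
  have "(\<integral>\<^sup>+ \<omega>. ennreal (x k \<omega> \<bullet> x k \<omega>) \<partial>P) \<le> ennreal (\<Sum>b\<in>Basis. qform V (vcat b 0))" for k
    using state [of k]
    by (simp add: nn_integral_inner_self integral_norm_sq_eq_sum ennreal_leI sum_mono)
  then have "(SUP k. \<integral>\<^sup>+ \<omega>. ennreal (x k \<omega> \<bullet> x k \<omega>) \<partial>P) \<le> ennreal (\<Sum>b\<in>Basis. qform V (vcat b 0))"
    by (intro SUP_least)
  also have "\<dots> < \<infinity>"
    by simp
  finally show ?thesis
    unfolding mean_square_stabilizable_def
    using \<mu> traj state by (intro exI [of _ \<mu>] exI [of _ x]) (auto simp: u square_integrable_matrix_vector_mult)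
qed

text \<open>
  The input itself need not be bounded in mean square, only its image under \<open>B\<close> is. Replacing
  \<open>u\<close> by \<open>L B u\<close> with a generalized inverse \<open>L\<close> leaves the dynamics unchanged and bounds the
  second moments, so that their Cesaro means have a convergent subsequence.
\<close>

lemma covariance_if_stabilizable:
  fixes A :: "real^'n^'n" and As :: "nat \<Rightarrow> real^'n^'n" and B :: "real^'m^'n"
  assumes "mean_square_stabilizable P M A As B w \<sigma>"
  obtains V :: "real^('n + 'm)^('n + 'm)" where "psd V"
    and "\<And>p. qform V (vcat p 0) = qform V (vcat (transpose A *v p) (transpose B *v p))
        + (\<Sum>i=1..M. qform V (vcat (transpose (As i) *v p) 0)) + p \<bullet> p"
proof -
  obtain \<mu> x where \<mu>: "causal_controller \<mu>"
    and traj: "system_trajectory P M A As B w \<sigma> x (feedback \<mu> x)"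
    and sq_u: "\<And>k. square_integrable P (feedback \<mu> x k)"
    and sup: "(SUP k. \<integral>\<^sup>+ \<omega>. ennreal (x k \<omega> \<bullet> x k \<omega>) \<partial>P) < \<infinity>"
    using assms by (auto simp: mean_square_stabilizable_def)
  define u where "u = feedback \<mu> x"
  obtain S where S: "(SUP k. \<integral>\<^sup>+ \<omega>. ennreal (x k \<omega> \<bullet> x k \<omega>) \<partial>P) = ennreal S" "0 \<le> S"
    using sup by (cases "SUP k. \<integral>\<^sup>+ \<omega>. ennreal (x k \<omega> \<bullet> x k \<omega>) \<partial>P") auto
  have nn: "(\<integral>\<^sup>+ \<omega>. ennreal (x k \<omega> \<bullet> x k \<omega>) \<partial>P) \<le> ennreal S" for k
    unfolding S(1) [symmetric] by (rule SUP_upper) simp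
  have sq_x: "square_integrable P (x k)" for k
    by (rule square_integrable_if_nn_integral_finite [OF state_second_moments(1) [OF traj \<mu>]])
      (rule le_less_trans [OF nn], simp)
  have x_le: "(\<integral>\<omega>. (norm (x k \<omega>))\<^sup>2 \<partial>P) \<le> S" for k
    using nn [of k] S(2) by (simp add: nn_integral_inner_self sq_x)
  note Suc = state_second_moments(3) [OF traj \<mu> sq_x sq_u, folded u_def]

  \<comment> \<open>The next state without its time-k noise. The noise only adds nonnegative terms
    to the second moment, so \<open>y k\<close> inherits the bound of
    \<open>x (Suc k)\<close>.\<close>
  define y where "y = (\<lambda>k \<omega>. A *v x k \<omega> + B *v u k \<omega>)"
  have sq_y: "square_integrable P (y k)" for k
    unfolding y_def u_def by (intro square_integrable_add square_integrable_matrix_vector_mult sq_x sq_u)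
  have y_le: "(\<integral>\<omega>. (norm (y k \<omega>))\<^sup>2 \<partial>P) \<le> S" for k
  proof -
    have "(\<integral>\<omega>. (p \<bullet> y k \<omega>)\<^sup>2 \<partial>P) \<le> (\<integral>\<omega>. (p \<bullet> x (Suc k) \<omega>)\<^sup>2 \<partial>P)" for p
      unfolding Suc y_def by (simp add: sum_nonneg)
    then have "(\<integral>\<omega>. (norm (y k \<omega>))\<^sup>2 \<partial>P) \<le> (\<integral>\<omega>. (norm (x (Suc k) \<omega>))\<^sup>2 \<partial>P)"
      by (simp add: integral_norm_sq_eq_sum sq_x sq_y sum_mono)
    also have "\<dots> \<le> S"
      by (rule x_le)
    finally show ?thesis .
  qed

  obtain L :: "real^'n^'m" where L: "\<And>v. B *v (L *v (B *v v)) = B *v v"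
    by (rule exists_generalized_inverse [of B]) blast
  define z :: "nat \<Rightarrow> 'a \<Rightarrow> real^('n + 'm)"
    where "z = (\<lambda>k \<omega>. vcat (x k \<omega>) (L *v (B *v u k \<omega>)))"
  have sq_z: "square_integrable P (z k)" for k
    unfolding z_def u_def
    by (intro square_integrable_vcat square_integrable_matrix_vector_mult sq_x sq_u)
  obtain c where c: "\<And>v. norm (L *v v) \<le> norm v * c"
    using bounded_linear.bounded [OF matrix_vector_mul_bounded_linear [of L]] by blast
  obtain d where d: "\<And>v. norm (- (L *v (A *v v))) \<le> norm v * d"
    using bounded_linear.bounded [OF matrix_vector_mul_bounded_linear [of "L ** A"]]
    by (auto simp: matrix_vector_mul_assoc)
  define C where "C = S + 2 * (S * c\<^sup>2) + 2 * (S * d\<^sup>2)"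
  have z_le: "(\<integral>\<omega>. (norm (z k \<omega>))\<^sup>2 \<partial>P) \<le> C" for k
  proof -
    have "(norm (z k \<omega>))\<^sup>2 \<le> (norm (x k \<omega>))\<^sup>2 + 2 * ((norm (y k \<omega>))\<^sup>2 * c\<^sup>2) + 2 * ((norm (x k \<omega>))\<^sup>2 * d\<^sup>2)" for \<omega>
    proof -
      have "L *v (B *v u k \<omega>) = L *v y k \<omega> + - (L *v (A *v x k \<omega>))"
        by (simp add: y_def matrix_vector_right_distrib)
      then have "(norm (L *v (B *v u k \<omega>)))\<^sup>2 \<le> 2 * (norm (L *v y k \<omega>))\<^sup>2 + 2 * (norm (- (L *v (A *v x k \<omega>))))\<^sup>2"
        by (simp only: norm_add_sq_le)
      moreover have "(norm (L *v y k \<omega>))\<^sup>2 \<le> (norm (y k \<omega>))\<^sup>2 * c\<^sup>2"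
        "(norm (- (L *v (A *v x k \<omega>))))\<^sup>2 \<le> (norm (x k \<omega>))\<^sup>2 * d\<^sup>2"
        unfolding power_mult_distrib [symmetric] by (intro power_mono c d norm_ge_zero)+
      ultimately show ?thesis
        by (simp add: z_def norm_vcat_sq)
    qed
    then have "(\<integral>\<omega>. (norm (z k \<omega>))\<^sup>2 \<partial>P)
        \<le> (\<integral>\<omega>. (norm (x k \<omega>))\<^sup>2 + 2 * ((norm (y k \<omega>))\<^sup>2 * c\<^sup>2) + 2 * ((norm (x k \<omega>))\<^sup>2 * d\<^sup>2) \<partial>P)"
      using square_integrableD(2) [OF sq_x [of k]] square_integrableD(2) [OF sq_y [of k]]
        square_integrableD(2) [OF sq_z [of k]] by (intro integral_mono) auto
    also have "\<dots> = (\<integral>\<omega>. (norm (x k \<omega>))\<^sup>2 \<partial>P) + 2 * ((\<integral>\<omega>. (norm (y k \<omega>))\<^sup>2 \<partial>P) * c\<^sup>2)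
        + 2 * ((\<integral>\<omega>. (norm (x k \<omega>))\<^sup>2 \<partial>P) * d\<^sup>2)"
      using square_integrableD(2) [OF sq_x [of k]] square_integrableD(2) [OF sq_y [of k]] by simp
    also have "\<dots> \<le> C"
      unfolding C_def by (intro add_mono mult_left_mono mult_right_mono x_le y_le) auto
    finally show ?thesis .
  qed

  define V where "V = (\<lambda>k. second_moment P (z k))"
  have norm_V: "norm (V k) \<le> C" for k
    unfolding V_def using norm_second_moment_le z_le by (rule order_trans)
  have form_V: "qform (V k) v = (\<integral>\<omega>. (v \<bullet> z k \<omega>)\<^sup>2 \<partial>P)" for k v
    unfolding V_def by (rule qform_second_moment [OF sq_z])
  define rhs where "rhs = (\<lambda>V p. qform V (vcat (transpose A *v p) (transpose B *v p))
        + (\<Sum>i=1..M. qform V (vcat (transpose (As i) *v p) 0)))"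
  have V_Suc: "qform (V (Suc k)) (vcat p 0) = rhs (V k) p + p \<bullet> p" for k p
  proof -
    \<comment> \<open>Since B L B = B, the modified input enters the dynamics exactly as u
      does.\<close>
    have "vcat (transpose A *v p) (transpose B *v p) \<bullet> z k \<omega> = p \<bullet> y k \<omega>" for \<omega>
      by (simp only: z_def inner_vcat inner_transpose L y_def inner_add_right)
    moreover have "vcat q 0 \<bullet> z k \<omega> = q \<bullet> x k \<omega>" for k q \<omega>
      by (simp add: z_def inner_vcat)
    ultimately show ?thesis
      by (simp only: form_V rhs_def inner_transpose Suc y_def)
  qed

  \<comment> \<open>Each mean covers the N + 1 matrices \<open>V 0\<close> to \<open>V N\<close>, so
    the divisor is never 0.\<close>
  define W where "W = (\<lambda>N. (1 / real (Suc N)) *\<^sub>R (\<Sum>k<Suc N. V k))"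
  have W_form: "qform (W N) v = (\<Sum>k<Suc N. qform (V k) v) / real (Suc N)" for N v
    by (simp only: W_def qform_scaleR qform_sum) simp
  have norm_W: "norm (W N) \<le> C" for N
  proof -
    have "norm (\<Sum>k<Suc N. V k) \<le> (\<Sum>k<Suc N. C)"
      by (rule order_trans [OF norm_sum]) (intro sum_mono norm_V)
    then show ?thesis
      by (simp add: W_def field_simps del: sum.lessThan_Suc)
  qed
  \<comment> \<open>\<open>rhs\<close> is linear in the matrix, so by \<open>V_Suc\<close> its value
    at the mean plus p \<bullet> p is the mean of the shifted sequence. The difference telescopes to
    the first and last terms.\<close>
  have defect: "qform (W N) (vcat p 0) - (rhs (W N) p + p \<bullet> p)
      = (qform (V 0) (vcat p 0) - qform (V (Suc N)) (vcat p 0)) / real (Suc N)" for N p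
  proof -
    have "rhs (W N) p = (\<Sum>k<Suc N. rhs (V k) p) / real (Suc N)"
      unfolding rhs_def W_form sum.distrib add_divide_distrib sum_divide_distrib
      by (subst sum.swap) (rule refl)
    then have "rhs (W N) p + p \<bullet> p = (\<Sum>k<Suc N. qform (V (Suc k)) (vcat p 0)) / real (Suc N)"
      by (simp add: V_Suc sum.distrib add_divide_distrib del: sum.lessThan_Suc)
    then have "qform (W N) (vcat p 0) - (rhs (W N) p + p \<bullet> p)
        = (\<Sum>k<Suc N. qform (V k) (vcat p 0) - qform (V (Suc k)) (vcat p 0)) / real (Suc N)"
      by (simp only: W_form sum_subtractf diff_divide_distrib)
    then show ?thesis
      by (simp only: sum_lessThan_telescope' [of "\<lambda>k. qform (V k) (vcat p 0)"])
  qed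
  have defect_lim: "(\<lambda>N. qform (W N) (vcat p 0) - (rhs (W N) p + p \<bullet> p)) \<longlonglongrightarrow> 0" for p
  proof -
    obtain K where K: "\<And>U. norm (qform U (vcat p 0 :: real^('n + 'm))) \<le> norm U * K" and "0 \<le> K"
      using bounded_linear.nonneg_bounded [OF bounded_linear_qform] by blast
    have q_le: "\<bar>qform (V k) (vcat p 0)\<bar> \<le> C * K" for k
      using K [of "V k"] mult_right_mono [OF norm_V \<open>0 \<le> K\<close>] by (simp add: order_trans)
    show ?thesis
    proof (rule Lim_null_comparison)
      show "(\<lambda>N. (2 * (C * K)) * inverse (real (Suc N))) \<longlonglongrightarrow> 0"
        using tendsto_mult_right_zero [OF LIMSEQ_inverse_real_of_nat] .
      have "\<bar>a - b\<bar> / r \<le> (2 * c) * inverse r" if "\<bar>a\<bar> \<le> c" "\<bar>b\<bar> \<le> c" "0 < r" for a b c r :: real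
        using that by (simp add: field_simps abs_le_iff)
      then show "\<forall>\<^sub>F N in sequentially. norm (qform (W N) (vcat p 0) - (rhs (W N) p + p \<bullet> p))
          \<le> (2 * (C * K)) * inverse (real (Suc N))"
        using q_le by (intro always_eventually allI) (simp add: defect abs_divide)
    qed
  qed

  \<comment> \<open>The limit point \<open>U\<close> of the means is the solution: symmetry,
    nonnegativity and, for each fixed p, the equation all pass to the limit by continuity.\<close>
  have "seq_compact (cball (0 :: real^('n + 'm)^('n + 'm)) C)"
    by (simp add: compact_imp_seq_compact)
  moreover have "\<forall>N. W N \<in> cball 0 C"
    using norm_W by simp
  ultimately obtain U r where r: "strict_mono r" and lim: "(W \<circ> r) \<longlonglongrightarrow> U"
    by (rule seq_compactE)
  have lim_form: "(\<lambda>n. qform (W (r n)) v) \<longlonglongrightarrow> qform U v" for v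
    using bounded_linear.tendsto [OF bounded_linear_qform lim, of v] by (simp add: o_def)
  have "(\<lambda>n. transpose (W (r n))) \<longlonglongrightarrow> transpose U"
    using bounded_linear.tendsto [OF bounded_linear_transpose lim] by (simp add: o_def)
  moreover have "transpose (W N) = W N" for N
    unfolding W_def
    by (simp only: linear_scale [OF bounded_linear.linear [OF bounded_linear_transpose]]
        transpose_sum V_def transpose_second_moment sq_z)
  ultimately have sym: "transpose U = U"
    using lim by (auto intro: LIMSEQ_unique simp: o_def)
  have "0 \<le> qform (W N) v" for N v
    unfolding W_form form_V by (intro divide_nonneg_nonneg sum_nonneg) auto
  then have "0 \<le> qform U v" for v
    by (intro LIMSEQ_le_const [OF lim_form]) blast
  then have psd: "psd U"
    using sym by (simp add: psd_def qform_def)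
  have eq: "qform U (vcat p 0) - (rhs U p + p \<bullet> p) = 0" for p
  proof (rule LIMSEQ_unique)
    show "(\<lambda>n. qform (W (r n)) (vcat p 0) - (rhs (W (r n)) p + p \<bullet> p)) \<longlonglongrightarrow> qform U (vcat p 0) - (rhs U p + p \<bullet> p)"
      unfolding rhs_def by (intro tendsto_intros lim_form)
    show "(\<lambda>n. qform (W (r n)) (vcat p 0) - (rhs (W (r n)) p + p \<bullet> p)) \<longlonglongrightarrow> 0"
      using LIMSEQ_subseq_LIMSEQ [OF defect_lim r] by (simp add: o_def)
  qed
  show ?thesis
    by (rule that [OF psd eq [unfolded rhs_def right_minus_eq]])
qed

end

theorem corollary1:
  fixes P :: "'a measure"
    and M :: nat
    and A :: "real^'n^'n"
    and As :: "nat \<Rightarrow> real^'n^'n"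
    and B :: "real^'m^'n"
    and w :: "nat \<Rightarrow> 'a \<Rightarrow> real^'n"
    and \<sigma> :: "nat \<Rightarrow> nat \<Rightarrow> 'a \<Rightarrow> real"
  assumes "prob_space P"
    and "\<And>k. square_integrable P (w k)"
    and "\<And>k i. i \<in> {1..M} \<Longrightarrow> square_integrable P (\<sigma> k i)"
    and "\<And>k. (\<integral>\<omega>. w k \<omega> \<partial>P) = 0"
    and "\<And>k i. i \<in> {1..M} \<Longrightarrow> (\<integral>\<omega>. \<sigma> k i \<omega> \<partial>P) = 0"
    and "mutually_independent P M w \<sigma>"
    and "\<And>k. (\<integral>\<omega>. (\<chi> a b. w k \<omega> $ a * w k \<omega> $ b) \<partial>P) = (mat 1 :: real^'n^'n)"
    and "\<And>k i. i \<in> {1..M} \<Longrightarrow> (\<integral>\<omega>. (\<sigma> k i \<omega>)\<^sup>2 \<partial>P) = 1"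
  shows "mean_square_stabilizable P M A As B w \<sigma> \<longleftrightarrow>
    (\<exists>V :: real^('n + 'm)^('n + 'm). psd V \<and>
      Fmat ** V ** transpose Fmat =
        hcat A B ** V ** transpose (hcat A B)
        + (\<Sum>i=1..M. As i ** Fmat ** V ** transpose Fmat ** transpose (As i))
        + mat 1)"
proof -
  interpret noise_process P M w \<sigma>
  proof (intro noise_process.intro noise_process_axioms.intro)
    show "second_moment P (w k) = mat 1" for k
      \<comment> \<open>The covariance hypothesis is spelled out entrywise, which is what the two
        definitions unfold to.\<close>
      unfolding second_moment_def outer_product_def by (fact assms(7))
  qed (fact assms)+
  show ?thesis
  proof
    assume "mean_square_stabilizable P M A As B w \<sigma>"
    then obtain V :: "real^('n + 'm)^('n + 'm)" where psd: "psd V"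
      and eq: "\<And>p. qform V (vcat p 0) = qform V (vcat (transpose A *v p) (transpose B *v p))
        + (\<Sum>i=1..M. qform V (vcat (transpose (As i) *v p) 0)) + p \<bullet> p"
      by (rule covariance_if_stabilizable) blast
    from psd have "transpose V = V"
      by (simp add: psd_def)
    from covariance_equation_iff_qform [OF this, THEN iffD2] psd eq
    show "\<exists>V :: real^('n + 'm)^('n + 'm). psd V \<and>
      Fmat ** V ** transpose Fmat =
        hcat A B ** V ** transpose (hcat A B)
        + (\<Sum>i=1..M. As i ** Fmat ** V ** transpose Fmat ** transpose (As i))
        + mat 1"
      by blast
  next
    assume "\<exists>V :: real^('n + 'm)^('n + 'm). psd V \<and>
      Fmat ** V ** transpose Fmat =
        hcat A B ** V ** transpose (hcat A B)
        + (\<Sum>i=1..M. As i ** Fmat ** V ** transpose Fmat ** transpose (As i))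
        + mat 1"
    then obtain V :: "real^('n + 'm)^('n + 'm)" where psd: "psd V"
      and eq: "Fmat ** V ** transpose Fmat =
        hcat A B ** V ** transpose (hcat A B)
        + (\<Sum>i=1..M. As i ** Fmat ** V ** transpose Fmat ** transpose (As i))
        + mat 1"
      by blast
    from psd have "transpose V = V"
      by (simp add: psd_def)
    from covariance_equation_iff_qform [OF this, THEN iffD1, OF eq]
    show "mean_square_stabilizable P M A As B w \<sigma>"
      by (intro stabilizable_if_covariance [OF psd]) blast
  qed
qed

end
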